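(* Let $q=2^d$ for some positive integer $d$, let $E=(\mathrm{GF}(q)^2,+)\cong C_2^{2d}$, let $K=C_{q+2}$ (written additively), and let $G=E\times K$. Let $\phi$ be the order $2$ automorphism of $G$ given by $((a,b),x)^\phi:=((b,a),-x)$. Let $e_1,\dots,e_{2d}$ be generators for $E$, where $e_1=(1,0)$ and $e_2=(0,1)$. Let $u$ be the unique element of order $2$ of $K$, and let $K=\langle u,y\rangle$, so that $|y|=(q+2)/2$. Define the subgroup of $\langle\phi\rangle\ltimes G$ $$\mathcal{G}:=\langle(\phi,e_1,0),\ (1,0,y),\ (1,0,u),\ (1,e_1+e_2,0),\ (1,e_i,0) : 3\le i\le 2d\rangle.$$ Then $\mathcal{G}$ is a nonabelian group containing a difference set with McFarland parameters $$\left(q^2(q+2),\ q(q+1),\ q\right).$$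
   Context: A subset $D$ of a finite group $G$ is a $(v,k,\lambda)$-difference set if $|G|=v$, $|D|=k$, and every nonidentity $g\in G$ can be expressed in exactly $\lambda$ ways as $d_1d_2^{-1}$ with $d_1,d_2\in D$. McFarland parameters, for a prime power $q$ and positive integer $s$, are $v=q^{s+1}\left(\frac{q^{s+1}-1}{q-1}+1\right)$, $k=q^s\,\frac{q^{s+1}-1}{q-1}$, $\lambda=q^s\,\frac{q^s-1}{q-1}$; here $s=1$. Elements of $\langle\phi\rangle\ltimes G$ are written as triples $(\alpha,b,c)$ with $\alpha\in\langle\phi\rangle$, $b\in E$, $c\in K$, where $(\alpha,b,c)$ stands for the pair $(\alpha,(b,c))$. Automorphisms act on the right and multiplication of pairs is $(\alpha,g)(\beta,h)=(\alpha\beta,\ g^\beta+h)$ for $\alpha,\beta\in\langle\phi\rangle$ and $g,h\in G$. $0$ denotes the identity of $E$ and of $K$.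
   Formalization: Added: ⟨e_1+e_2, e_3,…,e_{2d}⟩ is invariant under (a,b)↦(b,a); otherwise the group has order 2q²(q+2) and the claim fails (q=4, e_3=(w,0), e_4=(1,w)). For q=2, |y|=(q+2)/2 contradicts K=⟨u,y⟩ and is not required. *)

theory Defs
  imports "HOL-Algebra.Algebra" "HOL-Library.Product_Plus" "HOL-Library.Cardinality"
begin

definition difference_set ::
  "('g, 'm) monoid_scheme \<Rightarrow> 'g set \<Rightarrow> nat \<Rightarrow> nat \<Rightarrow> nat \<Rightarrow> bool" where
  "difference_set G D v k l \<longleftrightarrow>
     group G \<and> finite (carrier G) \<and> D \<subseteq> carrier G \<and> order G = v \<and> card D = k \<and>
     (\<forall>g \<in> carrier G - {\<one>\<^bsub>G\<^esub>}.
        card {(d1, d2). d1 \<in> D \<and> d2 \<in> D \<and> d1 \<otimes>\<^bsub>G\<^esub> inv\<^bsub>G\<^esub> d2 = g} = l)"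

text \<open>All three divisions below are exact for \<open>q \<ge> 2\<close>.\<close>

definition mcfarland_parameters :: "nat \<Rightarrow> nat \<Rightarrow> nat \<times> nat \<times> nat" where
  "mcfarland_parameters q s =
     (q ^ (s + 1) * ((q ^ (s + 1) - 1) div (q - 1) + 1),
      q ^ s * ((q ^ (s + 1) - 1) div (q - 1)),
      q ^ s * ((q ^ s - 1) div (q - 1)))"

text \<open>
  Automorphisms act on the right: \<open>x\<close> to the power \<open>\<alpha>\<close> is \<open>\<alpha> x\<close>, so the product
  \<open>\<alpha>\<beta>\<close> (first \<open>\<alpha>\<close>, then \<open>\<beta>\<close>) is \<open>\<beta> \<otimes> \<alpha>\<close> in \<^const>\<open>AutoGroup\<close>, whose
  multiplication is composition of functions.
\<close>

definition semidirect ::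
  "('g \<Rightarrow> 'g) set \<Rightarrow> ('g, 'm) monoid_scheme \<Rightarrow> (('g \<Rightarrow> 'g) \<times> 'g) monoid" where
  "semidirect A G =
     \<lparr>carrier = A \<times> carrier G,
      monoid.mult = (\<lambda>(\<alpha>, g) (\<beta>, h). (\<beta> \<otimes>\<^bsub>AutoGroup G\<^esub> \<alpha>, \<beta> g \<otimes>\<^bsub>G\<^esub> h)),
      one = (\<one>\<^bsub>AutoGroup G\<^esub>, \<one>\<^bsub>G\<^esub>)\<rparr>"

text \<open>The field \<open>GF(q)\<close> is a type \<open>'a\<close> of class \<open>field\<close> and \<open>finite\<close> with \<open>CARD('a) = q\<close>.\<close>

definition E_group :: "('a::{field,finite} \<times> 'a) monoid" where
  "E_group = \<lparr>carrier = UNIV, monoid.mult = (+), one = 0\<rparr>"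

definition K_group :: "nat \<Rightarrow> int monoid" where
  "K_group q = integer_mod_group (q + 2)"

definition EK_group :: "nat \<Rightarrow> (('a::{field,finite} \<times> 'a) \<times> int) monoid" where
  "EK_group q = E_group \<times>\<times> K_group q"

text \<open>
  Restricted to the carrier, since members of \<^const>\<open>AutoGroup\<close> are extensional functions.
\<close>

definition phi ::
  "nat \<Rightarrow> ('a::{field,finite} \<times> 'a) \<times> int \<Rightarrow> ('a \<times> 'a) \<times> int" where
  "phi q = (\<lambda>((a, b), x) \<in> carrier (EK_group q). ((b, a), inv\<^bsub>K_group q\<^esub> x))"

definition phi_EK_group ::
  "nat \<Rightarrow> (((('a::{field,finite} \<times> 'a) \<times> int) \<Rightarrow> (('a \<times> 'a) \<times> int))
            \<times> (('a \<times> 'a) \<times> int)) monoid" where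
  "phi_EK_group q = semidirect (generate (AutoGroup (EK_group q)) {phi q}) (EK_group q)"

text \<open>
  Conjugation by \<open>(\<phi>, e 1, 0)\<close> acts on \<open>E\<close> as the coordinate swap. Hence the group below meets
  \<open>E\<close> in the closure under the swap of the subgroup \<open>M\<close> generated by \<open>e 1 + e 2\<close> and
  \<open>e 3, \<dots>, e (2 * d)\<close>. For generators \<open>e 1, \<dots>, e (2 * d)\<close> of \<open>E\<close>, \<open>M\<close> has index 2 in \<open>E\<close>.
  If the swap preserves \<open>M\<close>, the group below has order \<open>q\<^sup>2 * (q + 2)\<close>; otherwise it contains
  \<open>E\<close> and is the whole semidirect product, of order \<open>2 * q\<^sup>2 * (q + 2)\<close>.
\<close>

definition twisted_group ::
  "nat \<Rightarrow> nat \<Rightarrow> (nat \<Rightarrow> 'a::{field,finite} \<times> 'a) \<Rightarrow> int \<Rightarrow> int \<Rightarrow>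
     (((('a \<times> 'a) \<times> int) \<Rightarrow> (('a \<times> 'a) \<times> int)) \<times> (('a \<times> 'a) \<times> int)) monoid" where
  "twisted_group d q e u y =
     (let S = phi_EK_group q; \<iota> = \<one>\<^bsub>AutoGroup (EK_group q)\<^esub> in
      S\<lparr>carrier := generate S
         ({(phi q, (e 1, 0)), (\<iota>, (0, y)), (\<iota>, (0, u)), (\<iota>, (e 1 + e 2, 0))}
            \<union> {(\<iota>, (e i, 0)) | i. i \<in> {3..2 * d}})\<rparr>)"

end

theory Submission
  imports Defs "HOL-Number_Theory.Residues"
begin

text \<open>
  The twisted group is not abelian, but it acts regularly, through automorphisms followed by
  translations, on the points of the abelian group \<open>G = E \<times> K\<close>. If the automorphism
  parts of a regular group of this kind map a difference set of \<open>G\<close> to itself, then the elements of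
  the group that lie over the difference set form a difference set of the group with the same
  parameters (\<open>difference_set_regular_transfer\<close>). So two things have to be found: a difference
  set of \<open>G\<close> that \<open>\<phi>\<close> maps to itself, and a proof that the twisted group is regular.

  The difference set is McFarland's: of the \<open>q + 2\<close> elements of \<open>K\<close>, all but \<open>u\<close> carry
  one line each of the plane \<open>E\<close>, and the difference set consists of the pairs \<open>(v, k)\<close> with \<open>v\<close> on
  the line of \<open>k\<close> (\<open>spread_difference_set\<close>). Any bijection from labels to lines works. For
  invariance under \<open>\<phi>\<close> the bijection has to intertwine negation of the labels with the
  coordinate swap of the lines. In characteristic 2 each of these involutions has one fixed point
  (the label \<open>0\<close>, and the diagonal line) among \<open>q + 1\<close> elements, so such a bijection exists
  (\<open>involutions_equivalent\<close>, \<open>equivariant_slope_labelling\<close>). Leaving out \<open>u\<close>, the second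
  fixed point of negation on \<open>K\<close>, is what makes the numbers agree.

  Regularity comes from the subgroup \<open>M\<close> of \<open>E\<close> generated by \<open>e 1 + e 2\<close> and the \<open>e i\<close> with
  \<open>i \<ge> 3\<close>. It has index 2 and misses \<open>e 1\<close>, because \<open>2 * d - 1\<close> elements cannot generate
  a group of order \<open>2 ^ (2 * d)\<close> and exponent 2 (\<open>generate_index_two\<close>). Together with the
  invariance of \<open>M\<close> under the swap this shows that the twisted group has exactly one element
  over each point \<open>(b, k)\<close> of \<open>G\<close>, with automorphism part trivial for \<open>b \<in> M\<close> and \<open>\<phi>\<close>
  otherwise (\<open>coset_graph_subgroup\<close>, \<open>generate_eq_coset_graph\<close>).
\<close>

section \<open>Semidirect products as groups\<close>

lemma autoD:
  assumes "\<alpha> \<in> auto G"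
  shows "bij_betw \<alpha> (carrier G) (carrier G)" and "\<alpha> \<in> hom G G"
  using assms by (auto simp: auto_def Bij_def)

lemma auto_closed: "\<alpha> \<in> auto G \<Longrightarrow> x \<in> carrier G \<Longrightarrow> \<alpha> x \<in> carrier G"
  using autoD(1) bij_betwE by blast

lemma carrier_AutoGroup [simp]: "carrier (AutoGroup G) = auto G"
  by (simp add: AutoGroup_def)

lemma one_AutoGroup: "\<one>\<^bsub>AutoGroup G\<^esub> = (\<lambda>x \<in> carrier G. x)"
  by (simp add: AutoGroup_def BijGroup_def)

lemma mult_AutoGroup:
  assumes "\<alpha> \<in> auto G" "\<beta> \<in> auto G"
  shows "\<alpha> \<otimes>\<^bsub>AutoGroup G\<^esub> \<beta> = compose (carrier G) \<alpha> \<beta>"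
  using assms by (simp add: AutoGroup_def BijGroup_def auto_def)

lemma mult_AutoGroup_apply:
  assumes "\<alpha> \<in> auto G" "\<beta> \<in> auto G" "x \<in> carrier G"
  shows "(\<alpha> \<otimes>\<^bsub>AutoGroup G\<^esub> \<beta>) x = \<alpha> (\<beta> x)"
  using assms by (simp add: mult_AutoGroup compose_def)

lemma carrier_semidirect [simp]: "carrier (semidirect A G) = A \<times> carrier G"
  by (simp add: semidirect_def)

lemma one_semidirect [simp]: "\<one>\<^bsub>semidirect A G\<^esub> = (\<one>\<^bsub>AutoGroup G\<^esub>, \<one>\<^bsub>G\<^esub>)"
  by (simp add: semidirect_def)

lemma mult_semidirect [simp]:
  "(\<alpha>, g) \<otimes>\<^bsub>semidirect A G\<^esub> (\<beta>, h) = (\<beta> \<otimes>\<^bsub>AutoGroup G\<^esub> \<alpha>, \<beta> g \<otimes>\<^bsub>G\<^esub> h)"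
  by (simp add: semidirect_def)

text \<open>
  The element \<open>\<alpha>' g\<close> that occurs in the inverse of \<open>(\<alpha>, g)\<close> also compares left translation in
  the semidirect product with left translation in \<open>G\<close>, so its properties are recorded together
  with the inverse law.
\<close>
lemma semidirect_left_inverse:
  assumes "group G" "subgroup A (AutoGroup G)" "\<alpha> \<in> A" "g \<in> carrier G"
  defines "\<alpha>' \<equiv> inv\<^bsub>AutoGroup G\<^esub> \<alpha>"
  shows "(\<alpha>', inv\<^bsub>G\<^esub> (\<alpha>' g)) \<otimes>\<^bsub>semidirect A G\<^esub> (\<alpha>, g) = \<one>\<^bsub>semidirect A G\<^esub>"
    and "\<alpha> (\<alpha>' g) = g" and "\<alpha>' \<in> A" and "\<alpha>' g \<in> carrier G"
proof -
  interpret G: group G by fact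
  interpret Aut: group "AutoGroup G" by (rule G.AutoGroup)
  have \<alpha>: "\<alpha> \<in> auto G"
    using subgroup.mem_carrier[OF assms(2,3)] by simp
  have \<alpha>': "\<alpha>' \<in> A"
    unfolding \<alpha>'_def using subgroup.m_inv_closed[OF assms(2,3)] .
  then have \<alpha>'_auto: "\<alpha>' \<in> auto G"
    using subgroup.mem_carrier[OF assms(2)] by fastforce
  have r: "\<alpha> \<otimes>\<^bsub>AutoGroup G\<^esub> \<alpha>' = \<one>\<^bsub>AutoGroup G\<^esub>"
    unfolding \<alpha>'_def using \<alpha> by (intro Aut.r_inv) simp
  show cl: "\<alpha>' g \<in> carrier G"
    using auto_closed[OF \<alpha>'_auto assms(4)] .
  show e: "\<alpha> (\<alpha>' g) = g"
    using mult_AutoGroup_apply[OF \<alpha> \<alpha>'_auto assms(4)] r assms(4) by (simp add: one_AutoGroup)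
  interpret h: group_hom G G \<alpha>
    using autoD(2)[OF \<alpha>] by (unfold_locales)
  show "(\<alpha>', inv\<^bsub>G\<^esub> (\<alpha>' g)) \<otimes>\<^bsub>semidirect A G\<^esub> (\<alpha>, g) = \<one>\<^bsub>semidirect A G\<^esub>"
    using r e cl assms(4) by simp
  show "\<alpha>' \<in> A" by fact
qed

lemma semidirect_group:
  assumes "group G" "subgroup A (AutoGroup G)"
  shows "group (semidirect A G)"
proof -
  interpret G: group G by fact
  interpret Aut: group "AutoGroup G" by (rule G.AutoGroup)
  have A: "\<alpha> \<in> auto G" if "\<alpha> \<in> A" for \<alpha>
    using subgroup.mem_carrier[OF assms(2) that] by simp
  have hom: "\<alpha> (x \<otimes>\<^bsub>G\<^esub> y) = \<alpha> x \<otimes>\<^bsub>G\<^esub> \<alpha> y"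
    if "\<alpha> \<in> A" "x \<in> carrier G" "y \<in> carrier G" for \<alpha> x y
    using autoD(2)[OF A[OF that(1)]] that(2,3) by (simp add: hom_mult)
  show ?thesis
  proof (rule groupI)
    show "x \<otimes>\<^bsub>semidirect A G\<^esub> y \<in> carrier (semidirect A G)"
      if "x \<in> carrier (semidirect A G)" "y \<in> carrier (semidirect A G)" for x y
      using that subgroup.m_closed[OF assms(2)] by (auto simp: auto_closed A)
    show "\<one>\<^bsub>semidirect A G\<^esub> \<in> carrier (semidirect A G)"
      using subgroup.one_closed[OF assms(2)] by simp
    show "x \<otimes>\<^bsub>semidirect A G\<^esub> y \<otimes>\<^bsub>semidirect A G\<^esub> z =
          x \<otimes>\<^bsub>semidirect A G\<^esub> (y \<otimes>\<^bsub>semidirect A G\<^esub> z)"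
      if "x \<in> carrier (semidirect A G)" "y \<in> carrier (semidirect A G)"
        "z \<in> carrier (semidirect A G)" for x y z
      using that
      by (auto simp: hom mult_AutoGroup_apply A auto_closed G.m_assoc Aut.m_assoc)
    show "\<one>\<^bsub>semidirect A G\<^esub> \<otimes>\<^bsub>semidirect A G\<^esub> x = x"
      if mem: "x \<in> carrier (semidirect A G)" for x
    proof -
      obtain \<alpha> g where x: "x = (\<alpha>, g)" "\<alpha> \<in> A" "g \<in> carrier G" using mem by auto
      have "\<alpha> \<one>\<^bsub>G\<^esub> = \<one>\<^bsub>G\<^esub>"
        using hom_one[OF autoD(2)[OF A[OF x(2)]] assms(1) assms(1)] .
      moreover have "\<alpha> \<otimes>\<^bsub>AutoGroup G\<^esub> \<one>\<^bsub>AutoGroup G\<^esub> = \<alpha>"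
        using A[OF x(2)] by (intro Aut.r_one) simp
      ultimately show ?thesis using x by simp
    qed
    show "\<exists>y\<in>carrier (semidirect A G). y \<otimes>\<^bsub>semidirect A G\<^esub> x = \<one>\<^bsub>semidirect A G\<^esub>"
      if mem: "x \<in> carrier (semidirect A G)" for x
    proof -
      obtain \<alpha> g where x: "x = (\<alpha>, g)" "\<alpha> \<in> A" "g \<in> carrier G" using mem by auto
      show ?thesis
        using semidirect_left_inverse[OF assms x(2,3)] unfolding x(1)
        by (metis G.inv_closed SigmaI carrier_semidirect)
    qed
  qed
qed


section \<open>Transfer of difference sets to regular groups\<close>

text \<open>
  Solving \<open>d1 = g \<otimes> d2\<close> makes \<open>d1\<close> redundant: the number of quotient representations of \<open>g\<close>
  is the size of the intersection of \<open>D\<close> with a left translate. All counting below is done in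
  this form.
\<close>
lemma card_quotients_eq_card_translate:
  assumes "group G" "D \<subseteq> carrier G" "g \<in> carrier G"
  shows "card {(d1, d2). d1 \<in> D \<and> d2 \<in> D \<and> d1 \<otimes>\<^bsub>G\<^esub> inv\<^bsub>G\<^esub> d2 = g} =
         card {d \<in> D. g \<otimes>\<^bsub>G\<^esub> d \<in> D}"
proof -
  interpret group G by fact
  have "{(d1, d2). d1 \<in> D \<and> d2 \<in> D \<and> d1 \<otimes>\<^bsub>G\<^esub> inv\<^bsub>G\<^esub> d2 = g} =
        (\<lambda>d. (g \<otimes>\<^bsub>G\<^esub> d, d)) ` {d \<in> D. g \<otimes>\<^bsub>G\<^esub> d \<in> D}"
  proof (intro subset_antisym subsetI)
    fix p assume "p \<in> {(d1, d2). d1 \<in> D \<and> d2 \<in> D \<and> d1 \<otimes>\<^bsub>G\<^esub> inv\<^bsub>G\<^esub> d2 = g}"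
    then obtain d1 d2 where p: "p = (d1, d2)" "d1 \<in> D" "d2 \<in> D" "d1 \<otimes>\<^bsub>G\<^esub> inv\<^bsub>G\<^esub> d2 = g" by auto
    then have "d1 = g \<otimes>\<^bsub>G\<^esub> d2" using assms(2,3) inv_solve_right' by blast
    with p show "p \<in> (\<lambda>d. (g \<otimes>\<^bsub>G\<^esub> d, d)) ` {d \<in> D. g \<otimes>\<^bsub>G\<^esub> d \<in> D}" by auto
  qed (use assms(2,3) in \<open>auto simp: inv_solve_right' subset_iff\<close>)
  then show ?thesis
    by (simp add: card_image inj_on_def)
qed

text \<open>
  If \<open>T\<close> acts regularly on the points of \<open>G\<close>, it inherits every difference set of \<open>G\<close> that
  its automorphism parts preserve. Let \<open>g = (\<alpha>, a)\<close> and
  \<open>t = (\<beta>, b)\<close> be in \<open>T\<close>. The point of \<open>g \<otimes> t\<close> is \<open>\<beta> a \<otimes> b = \<beta> (a \<otimes> r t)\<close>, where \<open>r t\<close> is the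
  preimage of \<open>b\<close> under \<open>\<beta>\<close>. Since \<open>\<beta>\<close> preserves \<open>D\<close>, this point is in \<open>D\<close> exactly if
  \<open>a \<otimes> r t\<close> is. The map \<open>r\<close> is injective, being inverse, projection and inverse composed,
  and it maps the lifted set into \<open>D\<close>, hence onto \<open>D\<close> by counting. So the translate count for
  \<open>g\<close> in \<open>T\<close> equals the one for \<open>a\<close> in \<open>G\<close>.
\<close>
lemma difference_set_regular_transfer:
  fixes G (structure)
  assumes A: "subgroup A (AutoGroup G)" and T: "subgroup T (semidirect A G)"
    and regular: "bij_betw snd T (carrier G)"
    and D: "difference_set G D v k l"
    and inv: "\<And>t. t \<in> T \<Longrightarrow> fst t ` D \<subseteq> D"
  shows "difference_set (semidirect A G\<lparr>carrier := T\<rparr>) {t \<in> T. snd t \<in> D} v k l"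
proof -
  let ?S = "semidirect A G"
  let ?T = "?S\<lparr>carrier := T\<rparr>"
  define D' where "D' = {t \<in> T. snd t \<in> D}"
  interpret G: group G using D by (simp add: difference_set_def)
  interpret S: group ?S using semidirect_group[OF G.is_group A] .
  interpret T: subgroup T ?S by fact
  have grpT: "group ?T" using T.subgroup_is_group[OF S.is_group] .
  have DG: "D \<subseteq> carrier G" and fin: "finite (carrier G)" and ord: "card (carrier G) = v"
    and cD: "card D = k"
    using D by (auto simp: difference_set_def order_def)
  have finD: "finite D" using DG fin finite_subset by blast
  have inj: "inj_on snd T" and im: "snd ` T = carrier G"
    using regular by (auto simp: bij_betw_def)
  have snd_D': "bij_betw snd D' D"
    unfolding D'_def bij_betw_def using inj im DG by (force simp: inj_on_def)
  have pres: "\<alpha> x \<in> D \<longleftrightarrow> x \<in> D" if "(\<alpha>, g) \<in> T" "x \<in> carrier G" for \<alpha> g x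
  proof -
    have "\<alpha> \<in> auto G"
      using subgroup.mem_carrier[OF A] T.mem_carrier[OF that(1)] by simp
    then have i: "inj_on \<alpha> (carrier G)" by (meson autoD(1) bij_betw_def)
    have "\<alpha> ` D = D"
      using inv[OF that(1)] endo_inj_surj[OF finD] inj_on_subset[OF i DG] by simp
    then show ?thesis using i that(2) DG by (metis image_eqI inj_on_image_mem_iff)
  qed
  \<comment> \<open>\<open>r\<close> undoes the twist by which the automorphism of \<open>t\<close> moves the left factor.\<close>
  define r where "r t = (inv\<^bsub>AutoGroup G\<^esub> (fst t)) (snd t)" for t
  have r: "fst t (r t) = snd t" "r t \<in> carrier G"
    "r t = inv\<^bsub>G\<^esub> (snd (inv\<^bsub>?S\<^esub> t))" if "t \<in> T" for t
  proof -
    obtain \<alpha> g where t: "t = (\<alpha>, g)" by fastforce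
    then have mem: "\<alpha> \<in> A" "g \<in> carrier G" using T.mem_carrier[OF that] by auto
    note * = semidirect_left_inverse[OF G.is_group A mem]
    show "fst t (r t) = snd t" "r t \<in> carrier G" using * by (auto simp: r_def t)
    have "inv\<^bsub>?S\<^esub> t = (inv\<^bsub>AutoGroup G\<^esub> \<alpha>, inv\<^bsub>G\<^esub> ((inv\<^bsub>AutoGroup G\<^esub> \<alpha>) g))"
      unfolding t using * mem by (intro S.inv_equality) auto
    then show "r t = inv\<^bsub>G\<^esub> (snd (inv\<^bsub>?S\<^esub> t))"
      using *(4) by (simp add: r_def t)
  qed
  have r_inj: "inj_on r T"
  proof (rule inj_onI)
    fix s t assume st: "s \<in> T" "t \<in> T" "r s = r t"
    then have "snd (inv\<^bsub>?S\<^esub> s) = snd (inv\<^bsub>?S\<^esub> t)"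
      using r(3) G.inv_inv im by (metis T.m_inv_closed imageI)
    then have "inv\<^bsub>?S\<^esub> s = inv\<^bsub>?S\<^esub> t"
      using inj st by (meson T.m_inv_closed inj_onD)
    then show "s = t" using st S.inv_inv T.mem_carrier by metis
  qed
  have r_D: "r t \<in> D \<longleftrightarrow> snd t \<in> D" if "t \<in> T" for t
    using pres[of "fst t" "snd t" "r t"] r[OF that] that by simp
  have r_bij: "bij_betw r D' D"
  proof -
    have i: "inj_on r D'" using r_inj by (auto simp: D'_def inj_on_def)
    have "r ` D' \<subseteq> D" using r_D by (auto simp: D'_def)
    moreover have "card (r ` D') = card D"
      using card_image[OF i] bij_betw_same_card[OF snd_D'] by simp
    ultimately show ?thesis using i finD by (simp add: bij_betw_def card_subset_eq)
  qed
  have count: "card {d \<in> D'. g \<otimes>\<^bsub>?T\<^esub> d \<in> D'} = l" if g: "g \<in> T" "g \<noteq> \<one>\<^bsub>?T\<^esub>" for g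
  proof -
    have hG: "snd g \<in> carrier G" using im g(1) by auto
    have h1: "snd g \<noteq> \<one>\<^bsub>G\<^esub>"
      using g inj_onD[OF inj, of g "\<one>\<^bsub>?S\<^esub>"] T.one_closed by auto
    have eq: "g \<otimes>\<^bsub>?T\<^esub> t \<in> D' \<longleftrightarrow> snd g \<otimes> r t \<in> D" if t: "t \<in> T" for t
    proof -
      obtain \<alpha> a \<beta> b where ab: "g = (\<alpha>, a)" "t = (\<beta>, b)" by fastforce
      have "\<beta> \<in> auto G"
        using subgroup.mem_carrier[OF A] T.mem_carrier[OF t] ab by simp
      then have "\<beta> (a \<otimes> r t) = \<beta> a \<otimes> b"
        using hom_mult[OF autoD(2)] r[OF t] hG ab by fastforce
      then have "snd (g \<otimes>\<^bsub>?S\<^esub> t) = \<beta> (a \<otimes> r t)" by (simp add: ab)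
      moreover have "g \<otimes>\<^bsub>?S\<^esub> t \<in> T" using T.m_closed[OF g(1) t] .
      ultimately show ?thesis
        using pres[of \<beta> b "a \<otimes> r t"] t r(2)[OF t] hG ab by (simp add: D'_def)
    qed
    have "bij_betw r {d \<in> D'. g \<otimes>\<^bsub>?T\<^esub> d \<in> D'} {d \<in> D. snd g \<otimes> d \<in> D}"
    proof (rule bij_betw_subset[OF r_bij])
      have "g \<otimes>\<^bsub>?T\<^esub> d \<in> D' \<longleftrightarrow> snd g \<otimes> r d \<in> D" if "d \<in> D'" for d
        using eq that by (simp add: D'_def)
      then show "r ` {d \<in> D'. g \<otimes>\<^bsub>?T\<^esub> d \<in> D'} = {d \<in> D. snd g \<otimes> d \<in> D}"
        using bij_betw_imp_surj_on[OF r_bij] by blast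
    qed auto
    then have "card {d \<in> D'. g \<otimes>\<^bsub>?T\<^esub> d \<in> D'} = card {d \<in> D. snd g \<otimes> d \<in> D}"
      by (rule bij_betw_same_card)
    also have "\<dots> = l"
      using D hG h1 card_quotients_eq_card_translate[OF G.is_group DG hG]
      by (simp add: difference_set_def)
    finally show ?thesis .
  qed
  have "card {(d1, d2). d1 \<in> D' \<and> d2 \<in> D' \<and> d1 \<otimes>\<^bsub>?T\<^esub> inv\<^bsub>?T\<^esub> d2 = g} = l"
    if "g \<in> carrier ?T - {\<one>\<^bsub>?T\<^esub>}" for g
    using count that by (subst card_quotients_eq_card_translate[OF grpT]) (auto simp: D'_def)
  moreover have "finite T" using regular fin bij_betw_finite by blast
  moreover have "order ?T = v"
    using bij_betw_same_card[OF regular] ord by (simp add: order_def)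
  moreover have "card D' = k" using bij_betw_same_card[OF snd_D'] cD by simp
  ultimately show ?thesis
    using grpT unfolding difference_set_def D'_def[symmetric] by (auto simp: D'_def)
qed

section \<open>Difference sets from spreads\<close>

text \<open>
  Complementary subgroups factor the group uniquely: \<open>(w, v) \<mapsto> w \<otimes> inv v\<close> is injective on
  \<open>H' \<times> H\<close>, hence onto by counting. A \<open>v\<close> with \<open>a \<otimes> v \<in> H'\<close> is the second part of such a
  factorization of \<open>a\<close>.
\<close>
lemma complements_translate_meets_once:
  fixes G (structure)
  assumes "group G" and H: "subgroup H G" and H': "subgroup H' G"
    and "H \<inter> H' = {\<one>}" and "card H * card H' = order G" and "finite (carrier G)"
    and a: "a \<in> carrier G"
  shows "card {v \<in> H. a \<otimes> v \<in> H'} = 1"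
proof -
  interpret group G by fact
  interpret H: subgroup H G by fact
  interpret H': subgroup H' G by fact
  let ?f = "\<lambda>(w, v). w \<otimes> inv v"
  have inj: "inj_on ?f (H' \<times> H)"
  proof (rule inj_onI, clarify)
    fix w v w' v' assume *: "w \<in> H'" "v \<in> H" "w' \<in> H'" "v' \<in> H" "w \<otimes> inv v = w' \<otimes> inv v'"
    have c: "w \<in> carrier G" "v \<in> carrier G" "w' \<in> carrier G" "v' \<in> carrier G"
      using * by (auto simp: H.mem_carrier H'.mem_carrier)
    have "w' = w \<otimes> inv v \<otimes> v'"
      using *(5) c inv_solve_right'[of "w' \<otimes> inv v'"] by (metis inv_closed inv_solve_right' m_closed)
    then have "inv w' \<otimes> w = inv v' \<otimes> (v \<otimes> inv w \<otimes> w)"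
      using c by (simp add: inv_mult_group m_assoc)
    then have "inv w' \<otimes> w = inv v' \<otimes> v"
      using c by (simp add: m_assoc)
    moreover have "inv w' \<otimes> w \<in> H'" "inv v' \<otimes> v \<in> H" using * by auto
    ultimately have "inv w' \<otimes> w = \<one>" "inv v' \<otimes> v = \<one>" using assms(4) by auto
    then show "w = w' \<and> v = v'"
      using c inv_equality[of "inv w'" w] inv_equality[of "inv v'" v] by (metis inv_closed inv_inv)
  qed
  have "?f ` (H' \<times> H) = carrier G"
  proof (rule card_subset_eq[OF assms(6)])
    show "?f ` (H' \<times> H) \<subseteq> carrier G" by (auto simp: H.mem_carrier H'.mem_carrier)
    show "card (?f ` (H' \<times> H)) = card (carrier G)"
      using assms(5) by (simp add: card_image[OF inj] order_def card_cartesian_product mult.commute)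
  qed
  then have "a \<in> ?f ` (H' \<times> H)" using a by simp
  then obtain w v where wv: "w \<in> H'" "v \<in> H" "a = w \<otimes> inv v" by auto
  have "{v \<in> H. a \<otimes> v \<in> H'} = {v}"
  proof -
    have "a \<otimes> v \<in> H'" using wv by (simp add: m_assoc H.mem_carrier H'.mem_carrier)
    moreover have "v' = v" if "v' \<in> H" "a \<otimes> v' \<in> H'" for v'
    proof -
      have "?f (a \<otimes> v', v') = ?f (w, v)"
        using that(1) wv a by (simp add: m_assoc H.mem_carrier)
      then show ?thesis using inj_onD[OF inj] that wv by blast
    qed
    ultimately show ?thesis using wv(2) by blast
  qed
  then show ?thesis by simp
qed

text \<open>
  McFarland's construction for \<open>s = 1\<close>. The \<open>q + 1\<close> components \<open>L k\<close> of a spread of \<open>E\<close>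
  are placed over \<open>q + 1\<close> of the \<open>q + 2\<close> elements of \<open>K\<close>. For a translation by
  \<open>(a, \<one>)\<close> with \<open>a \<noteq> \<one>\<close>, only the one component that contains \<open>a\<close> meets its
  translate, in all of its \<open>q\<close> elements. For a translation by \<open>(a, x)\<close> with \<open>x \<noteq> \<one>\<close>,
  distinct components are compared; they are complementary, so each pair contributes one element, and
  \<open>q\<close> of the \<open>k\<close> give a pair because \<open>k\<close> and \<open>x \<otimes> k\<close> both have to avoid \<open>u\<close>.
\<close>
lemma spread_difference_set:
  fixes E :: "('a, 'm) monoid_scheme" and K :: "('b, 'n) monoid_scheme"
  assumes "group E" "group K" "finite (carrier E)" "finite (carrier K)"
    and oE: "order E = q\<^sup>2" and oK: "order K = q + 2" and u: "u \<in> carrier K"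
    and sub: "\<And>k. k \<in> carrier K - {u} \<Longrightarrow> subgroup (L k) E"
    and cL: "\<And>k. k \<in> carrier K - {u} \<Longrightarrow> card (L k) = q"
    and spread: "\<And>a. a \<in> carrier E \<Longrightarrow> a \<noteq> \<one>\<^bsub>E\<^esub> \<Longrightarrow> \<exists>!k. k \<in> carrier K - {u} \<and> a \<in> L k"
  shows "difference_set (E \<times>\<times> K) {(v, k). k \<in> carrier K - {u} \<and> v \<in> L k}
           (q\<^sup>2 * (q + 2)) (q * (q + 1)) q"
proof -
  interpret E: group E by fact
  interpret K: group K by fact
  define I where "I = carrier K - {u}"
  define D where "D = {(v, k). k \<in> I \<and> v \<in> L k}"
  have grp: "group (E \<times>\<times> K)" by (intro DirProd_group E.is_group K.is_group)
  have finI: "finite I" and cI: "card I = q + 1"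
    using assms(4) oK u by (auto simp: I_def order_def)
  have LE: "L k \<subseteq> carrier E" if "k \<in> I" for k
    using subgroup.subset[OF sub] that by (simp add: I_def)
  then have finL: "finite (L k)" if "k \<in> I" for k
    using that assms(3) finite_subset by blast
  have DG: "D \<subseteq> carrier (E \<times>\<times> K)" using LE by (auto simp: D_def I_def)
  have fibres: "card {(v, k). k \<in> J \<and> v \<in> F k} = (\<Sum>k\<in>J. card (F k))"
    if "J \<subseteq> I" "\<And>k. k \<in> J \<Longrightarrow> F k \<subseteq> L k" for F J
  proof -
    have fin: "finite (F k)" if "k \<in> J" for k
      using that \<open>J \<subseteq> I\<close> \<open>\<And>k. k \<in> J \<Longrightarrow> F k \<subseteq> L k\<close> finL finite_subset by blast
    have "{(v, k). k \<in> J \<and> v \<in> F k} = prod.swap ` Sigma J F" by auto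
    then have "card {(v, k). k \<in> J \<and> v \<in> F k} = card (Sigma J F)"
      by (simp add: card_image)
    then show ?thesis
      using fin finite_subset[OF that(1) finI] by simp
  qed
  have count: "card {d \<in> D. (a, x) \<otimes>\<^bsub>E \<times>\<times> K\<^esub> d \<in> D} = q"
    if a: "a \<in> carrier E" and x: "x \<in> carrier K" and ne: "(a, x) \<noteq> (\<one>\<^bsub>E\<^esub>, \<one>\<^bsub>K\<^esub>)" for a x
  proof -
    define J where "J = {k \<in> I. x \<otimes>\<^bsub>K\<^esub> k \<in> I}"
    define F where "F k = {v \<in> L k. a \<otimes>\<^bsub>E\<^esub> v \<in> L (x \<otimes>\<^bsub>K\<^esub> k)}" for k
    have "{d \<in> D. (a, x) \<otimes>\<^bsub>E \<times>\<times> K\<^esub> d \<in> D} = {(v, k). k \<in> J \<and> v \<in> F k}"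
      by (auto simp: D_def J_def F_def)
    then have *: "card {d \<in> D. (a, x) \<otimes>\<^bsub>E \<times>\<times> K\<^esub> d \<in> D} = (\<Sum>k\<in>J. card (F k))"
      using fibres[of J F] by (auto simp: J_def F_def)
    show ?thesis
    proof (cases "x = \<one>\<^bsub>K\<^esub>")
      case True
      then have "a \<noteq> \<one>\<^bsub>E\<^esub>" using ne by simp
      then obtain k0 where k0: "k0 \<in> I" "a \<in> L k0" "\<And>k. k \<in> I \<Longrightarrow> a \<in> L k \<Longrightarrow> k = k0"
        using spread[OF a] unfolding I_def by blast
      have J: "J = I" using True by (auto simp: J_def I_def)
      have F: "F k = (if k = k0 then L k0 else {})" if "k \<in> I" for k
      proof -
        interpret L: subgroup "L k" E using sub that by (simp add: I_def)
        have xk: "x \<otimes>\<^bsub>K\<^esub> k = k" using True that by (simp add: I_def)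
        have "a \<otimes>\<^bsub>E\<^esub> v \<in> L k \<longleftrightarrow> a \<in> L k" if v: "v \<in> L k" for v
        proof
          assume "a \<otimes>\<^bsub>E\<^esub> v \<in> L k"
          then have "a \<otimes>\<^bsub>E\<^esub> v \<otimes>\<^bsub>E\<^esub> inv\<^bsub>E\<^esub> v \<in> L k" using v by blast
          then show "a \<in> L k" using a v L.mem_carrier by (simp add: E.m_assoc)
        qed (use v in auto)
        then have "F k = {v \<in> L k. a \<in> L k}" unfolding F_def xk by blast
        moreover have "a \<in> L k \<longleftrightarrow> k = k0" using k0 that by blast
        ultimately show ?thesis by auto
      qed
      have "(\<Sum>k\<in>J. card (F k)) = (\<Sum>k\<in>I. if k = k0 then card (L k0) else 0)"
        unfolding J by (intro sum.cong) (auto simp: F)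
      also have "\<dots> = q" using k0(1) cL[of k0] finI by (simp add: I_def)
      finally show ?thesis using * by simp
    next
      case False
      have one: "card (F k) = 1" if "k \<in> J" for k
      proof -
        have k: "k \<in> I" "x \<otimes>\<^bsub>K\<^esub> k \<in> I" "k \<in> carrier K" using that by (auto simp: J_def I_def)
        have "x \<otimes>\<^bsub>K\<^esub> k \<noteq> k" using False x k(3) by simp
        then have "b = \<one>\<^bsub>E\<^esub>" if "b \<in> L k" "b \<in> L (x \<otimes>\<^bsub>K\<^esub> k)" for b
          using spread[of b] LE[OF k(1)] k(1,2) that unfolding I_def by (metis subsetD)
        then have "L k \<inter> L (x \<otimes>\<^bsub>K\<^esub> k) \<subseteq> {\<one>\<^bsub>E\<^esub>}" by blast
        moreover have "\<one>\<^bsub>E\<^esub> \<in> L k \<inter> L (x \<otimes>\<^bsub>K\<^esub> k)"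
          using k sub subgroup.one_closed by (auto simp: I_def)
        ultimately have "L k \<inter> L (x \<otimes>\<^bsub>K\<^esub> k) = {\<one>\<^bsub>E\<^esub>}" by blast
        then show ?thesis
          unfolding F_def using k sub cL oE assms(3) a
          by (intro complements_translate_meets_once) (auto simp: I_def power2_eq_square)
      qed
      let ?w = "inv\<^bsub>K\<^esub> x \<otimes>\<^bsub>K\<^esub> u"
      have eq: "x \<otimes>\<^bsub>K\<^esub> k = u \<longleftrightarrow> k = ?w" if "k \<in> carrier K" for k
        using K.inv_solve_left[OF that x u] by auto
      have "J = carrier K - {u, ?w}"
      proof -
        have "x \<otimes>\<^bsub>K\<^esub> k \<in> I \<longleftrightarrow> k \<noteq> ?w" if "k \<in> I" for k
          using eq[of k] that x by (simp add: I_def)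
        then have "J = I - {?w}" unfolding J_def by blast
        then show ?thesis unfolding I_def by blast
      qed
      moreover have "?w \<in> carrier K" using x u by simp
      moreover have "?w \<noteq> u" using False eq[OF u] x u by auto
      ultimately have "card J = q"
        using oK assms(4) u by (simp add: order_def card_Diff_subset)
      then show ?thesis using * one by simp
    qed
  qed
  have "card {(d1, d2). d1 \<in> D \<and> d2 \<in> D \<and> d1 \<otimes>\<^bsub>E \<times>\<times> K\<^esub> inv\<^bsub>E \<times>\<times> K\<^esub> d2 = g} = q"
    if "g \<in> carrier (E \<times>\<times> K) - {\<one>\<^bsub>E \<times>\<times> K\<^esub>}" for g
  proof -
    obtain a x where g: "g = (a, x)" by fastforce
    show ?thesis
      using that count[of a x] unfolding g
      by (subst card_quotients_eq_card_translate[OF grp DG]) simp_all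
  qed
  moreover have "card D = q * (q + 1)"
  proof -
    have "card D = (\<Sum>k\<in>I. card (L k))" unfolding D_def by (rule fibres) auto
    also have "\<dots> = (\<Sum>k\<in>I. q)" by (rule sum.cong) (auto simp: I_def cL)
    finally show ?thesis using cI by simp
  qed
  moreover have "order (E \<times>\<times> K) = q\<^sup>2 * (q + 2)"
    using oE oK by (simp add: order_def card_cartesian_product)
  moreover have "finite (carrier (E \<times>\<times> K))" using assms(3,4) by simp
  ultimately have "difference_set (E \<times>\<times> K) D (q\<^sup>2 * (q + 2)) (q * (q + 1)) q"
    unfolding difference_set_def using grp DG by blast
  then show ?thesis unfolding D_def I_def .
qed

section \<open>Involutions with equally many fixed points\<close>

text \<open>
  An involution of a finite set is determined up to relabelling by its number of fixed points: a
  two-element orbit of one involution is matched with a two-element orbit of the other until only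
  fixed points are left.
\<close>
lemma involutions_equivalent:
  assumes "finite A" "finite B" "card A = card B"
    and "\<And>a. a \<in> A \<Longrightarrow> f a \<in> A" "\<And>a. a \<in> A \<Longrightarrow> f (f a) = a"
    and "\<And>b. b \<in> B \<Longrightarrow> g b \<in> B" "\<And>b. b \<in> B \<Longrightarrow> g (g b) = b"
    and "card {a \<in> A. f a = a} = card {b \<in> B. g b = b}"
  shows "\<exists>h. bij_betw h A B \<and> (\<forall>a\<in>A. h (f a) = g (h a))"
  using assms
proof (induction "card A" arbitrary: A B rule: less_induct)
  case less
  show ?case
  proof (cases "\<exists>a\<in>A. f a \<noteq> a")
    case False
    then have fA: "{a \<in> A. f a = a} = A" by auto
    then have "{b \<in> B. g b = b} = B"
      using less.prems by (intro card_subset_eq) auto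
    then have gB: "g b = b" if "b \<in> B" for b using that by auto
    obtain h where h: "bij_betw h A B"
      using less.prems(1-3) finite_same_card_bij by blast
    then have "h (f a) = g (h a)" if "a \<in> A" for a
      using that False gB bij_betwE by fastforce
    with h show ?thesis by blast
  next
    case True
    then obtain a where a: "a \<in> A" "f a \<noteq> a" by blast
    have "{a \<in> A. f a = a} \<subset> A" using a by auto
    then have "card {b \<in> B. g b = b} < card B"
      using less.prems psubset_card_mono by metis
    then have "{b \<in> B. g b = b} \<noteq> B" by auto
    then obtain b where b: "b \<in> B" "g b \<noteq> b" by blast
    note facts = less.prems(4)[OF a(1)] less.prems(5)[OF a(1)] less.prems(6)[OF b(1)] less.prems(7)[OF b(1)]
    define A' where "A' = A - {a, f a}"
    define B' where "B' = B - {b, g b}"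
    have cA: "card A' = card A - 2" "card A \<ge> 2"
      using a facts less.prems(1) card_mono[of A "{a, f a}"]
      by (auto simp: A'_def card_Diff_subset)
    have cB: "card B' = card B - 2"
      using b facts less.prems(2) by (auto simp: B'_def card_Diff_subset)
    have "\<exists>h. bij_betw h A' B' \<and> (\<forall>a\<in>A'. h (f a) = g (h a))"
    proof (rule less.hyps)
      show "card A' < card A" "card A' = card B'" using cA cB less.prems(3) by auto
      show "finite A'" "finite B'" using less.prems(1,2) by (auto simp: A'_def B'_def)
      show "f x \<in> A'" "f (f x) = x" if "x \<in> A'" for x
        using that less.prems(4,5) facts unfolding A'_def by (auto, metis+)
      show "g x \<in> B'" "g (g x) = x" if "x \<in> B'" for x
        using that less.prems(6,7) facts unfolding B'_def by (auto, metis+)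
      have "{x \<in> A'. f x = x} = {x \<in> A. f x = x}" using a facts by (auto simp: A'_def)
      moreover have "{x \<in> B'. g x = x} = {x \<in> B. g x = x}" using b facts by (auto simp: B'_def)
      ultimately show "card {x \<in> A'. f x = x} = card {x \<in> B'. g x = x}"
        using less.prems(8) by simp
    qed
    then obtain h where h: "bij_betw h A' B'" "\<And>x. x \<in> A' \<Longrightarrow> h (f x) = g (h x)" by blast
    define h' where "h' x = (if x = a then b else if x = f a then g b else h x)" for x
    have "bij_betw h' A' B'"
      using h(1) by (rule bij_betw_cong[THEN iffD1, rotated]) (auto simp: h'_def A'_def)
    moreover have "bij_betw h' {a, f a} {b, g b}"
      using a b by (auto simp: bij_betw_def h'_def)
    moreover have "A' \<inter> {a, f a} = {}" "B' \<inter> {b, g b} = {}"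
      by (auto simp: A'_def B'_def)
    ultimately have "bij_betw h' (A' \<union> {a, f a}) (B' \<union> {b, g b})"
      by (intro bij_betw_combine)
    moreover have "A' \<union> {a, f a} = A" "B' \<union> {b, g b} = B"
      using a b facts by (auto simp: A'_def B'_def)
    moreover have "h' (f x) = g (h' x)" if "x \<in> A" for x
    proof (cases "x \<in> {a, f a}")
      case True
      then show ?thesis using a b facts by (auto simp: h'_def)
    next
      case False
      then have "x \<in> A'" "f x \<noteq> a" "f x \<noteq> f a"
        using that facts less.prems(5) by (auto simp: A'_def) metis+
      then show ?thesis using False h(2) by (auto simp: h'_def)
    qed
    ultimately show ?thesis by auto
  qed
qed

section \<open>Lines of the plane in characteristic 2\<close>

lemma char_2_of_card:
  assumes "CARD('a::{field,finite}) = 2 ^ d"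
  shows "(x::'a) + x = 0"
proof -
  have "Factorial_Ring.prime CHAR('a)" by (simp add: prime_CHAR_semidom finite_imp_CHAR_pos)
  moreover have "CHAR('a) dvd 2 ^ d" using CHAR_dvd_CARD[where 'a = 'a] assms by simp
  ultimately have "CHAR('a) = 2"
    by (metis prime_dvd_power primes_dvd_imp_eq two_is_prime_nat)
  then have "(2::'a) = 0" using of_nat_CHAR[where 'a = 'a] by simp
  then show ?thesis by (metis mult_2 mult_zero_left)
qed

text \<open>
  The lines through the origin of the plane, indexed by their slopes; \<^term>\<open>None\<close> is the slope
  of the vertical line. Indexing by slopes gives their number without a count of orbits.
\<close>
fun slope_line :: "'a::field option \<Rightarrow> ('a \<times> 'a) set" where
  "slope_line None = range (\<lambda>y. (0, y))"
| "slope_line (Some m) = range (\<lambda>x. (x, m * x))"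

fun swap_slope :: "'a::field option \<Rightarrow> 'a option" where
  "swap_slope None = Some 0"
| "swap_slope (Some m) = (if m = 0 then None else Some (inverse m))"

lemma swap_slope_involution: "swap_slope (swap_slope s) = s"
  by (cases s) auto

lemma swap_slope_line: "prod.swap ` slope_line s \<subseteq> slope_line (swap_slope s)"
proof (cases s)
  case (Some m)
  have "(m * x, x) \<in> range (\<lambda>z. (z, inverse m * z))" if "m \<noteq> 0" for x
    using that by (intro image_eqI[of _ _ "m * x"]) auto
  then show ?thesis using Some by auto
qed auto

text \<open>
  A fixed slope satisfies \<open>m\<^sup>2 = 1\<close>, that is \<open>(m + 1)\<^sup>2 = 0\<close> in characteristic 2, so only the
  diagonal line is invariant under the swap.
\<close>
lemma swap_slope_fixed:
  assumes "\<And>x::'a::field. x + x = 0"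
  shows "{s::'a option. swap_slope s = s} = {Some 1}"
proof -
  have "m = 1" if "m \<noteq> 0" "inverse m = m" for m :: 'a
  proof -
    have "m * m = 1" using that by (metis right_inverse)
    then have "(m + 1) * (m + 1) = m + m + (1 + 1)" by (simp add: algebra_simps)
    then have "m + 1 = 0" using assms by simp
    then show ?thesis using assms[of 1] by (metis add_right_imp_eq)
  qed
  then show ?thesis
    by (auto split: if_splits elim!: swap_slope.elims)
qed

lemma card_slope_line: "card (slope_line (s :: 'a::{field,finite} option)) = CARD('a)"
  by (cases s) (auto simp: card_image inj_on_def)

lemma slope_lines_spread:
  assumes "v \<noteq> (0::'a::field \<times> 'a)"
  shows "\<exists>!s. v \<in> slope_line s"
proof -
  obtain a b where v: "v = (a, b)" by fastforce
  have "v \<in> slope_line s \<longleftrightarrow> s = (if a = 0 then None else Some (b / a))" for s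
    using assms by (cases s) (auto simp: v zero_prod_def field_simps)
  then show ?thesis by auto
qed

lemma E_group_simps [simp]:
  "carrier E_group = UNIV" "x \<otimes>\<^bsub>E_group\<^esub> y = x + y" "\<one>\<^bsub>E_group\<^esub> = 0"
  by (simp_all add: E_group_def)

lemma E_group_group: "group E_group"
  proof (rule groupI)
  show "\<exists>y\<in>carrier E_group. y \<otimes>\<^bsub>E_group\<^esub> x = \<one>\<^bsub>E_group\<^esub>" for x :: "'a \<times> 'a"
    by (rule bexI[of _ "- x"]) auto
qed (auto simp: add.assoc)

lemma slope_line_subgroup: "subgroup (slope_line s) E_group"
proof -
  interpret group E_group by (rule E_group_group)
  have inv: "inv\<^bsub>E_group\<^esub> x = - x" for x :: "'a \<times> 'a" by (rule inv_equality) auto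
  show ?thesis
    by (rule subgroupI, unfold inv) (cases s; auto simp: algebra_simps)+
qed

section \<open>Groups generated by involutions\<close>

text \<open>
  Adjoining one involution to a subgroup of an abelian group at most doubles it, since the union of
  the subgroup and one coset is already closed. This gives both the index and the cardinality
  estimates for the subgroup \<open>M\<close> of \<open>E\<close>.
\<close>
lemma generate_insert_involution:
  fixes G (structure)
  assumes "comm_group G" "A \<subseteq> carrier G" "a \<in> carrier G" "a \<otimes> a = \<one>"
  shows "generate G (insert a A) \<subseteq> generate G A \<union> (\<lambda>x. a \<otimes> x) ` generate G A"
proof -
  interpret comm_group G by fact
  let ?H = "generate G A"
  interpret H: subgroup ?H G using generate_is_subgroup[OF assms(2)] .
  have aa: "a \<otimes> (a \<otimes> x) = x" if "x \<in> carrier G" for x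
    using assms(3,4) that by (simp add: m_assoc[symmetric])
  have ia: "inv a = a" using assms(3,4) inv_equality by blast
  have "subgroup (?H \<union> (\<lambda>x. a \<otimes> x) ` ?H) G"
  proof (rule subgroupI)
    show "?H \<union> (\<lambda>x. a \<otimes> x) ` ?H \<subseteq> carrier G" using assms(3) by auto
    show "?H \<union> (\<lambda>x. a \<otimes> x) ` ?H \<noteq> {}" using H.one_closed by blast
    show "inv x \<in> ?H \<union> (\<lambda>x. a \<otimes> x) ` ?H" if "x \<in> ?H \<union> (\<lambda>x. a \<otimes> x) ` ?H" for x
      using that assms(3) by (auto simp: inv_mult ia)
    show "x \<otimes> y \<in> ?H \<union> (\<lambda>x. a \<otimes> x) ` ?H"
      if xy: "x \<in> ?H \<union> (\<lambda>x. a \<otimes> x) ` ?H" "y \<in> ?H \<union> (\<lambda>x. a \<otimes> x) ` ?H" for x y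
    proof -
      have "a \<otimes> h \<otimes> h' = a \<otimes> (h \<otimes> h')" "h \<otimes> (a \<otimes> h') = a \<otimes> (h \<otimes> h')"
        "a \<otimes> h \<otimes> (a \<otimes> h') = h \<otimes> h'" if "h \<in> ?H" "h' \<in> ?H" for h h'
      proof -
        have c: "h \<in> carrier G" "h' \<in> carrier G" using that by auto
        then show "a \<otimes> h \<otimes> h' = a \<otimes> (h \<otimes> h')" "h \<otimes> (a \<otimes> h') = a \<otimes> (h \<otimes> h')"
          using assms(3) by (simp_all add: m_ac)
        have "a \<otimes> h \<otimes> (a \<otimes> h') = a \<otimes> (a \<otimes> (h \<otimes> h'))" using c assms(3) by (simp add: m_ac)
        then show "a \<otimes> h \<otimes> (a \<otimes> h') = h \<otimes> h'" using aa c by simp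
      qed
      then show ?thesis using xy by fastforce
    qed
  qed
  moreover have "insert a A \<subseteq> ?H \<union> (\<lambda>x. a \<otimes> x) ` ?H"
  proof -
    have "a = a \<otimes> \<one>" using assms(3) by simp
    then have "a \<in> (\<lambda>x. a \<otimes> x) ` ?H" using H.one_closed by blast
    then show ?thesis using generate.incl[of _ A G] by auto
  qed
  ultimately show ?thesis by (intro generate_subgroup_incl)
qed

lemma card_generate_involutions:
  fixes G (structure)
  assumes "comm_group G" "finite A" "A \<subseteq> carrier G" "\<And>a. a \<in> A \<Longrightarrow> a \<otimes> a = \<one>"
  shows "finite (generate G A) \<and> card (generate G A) \<le> 2 ^ card A"
  using assms(2-4)
proof (induction A rule: finite_induct)
  case empty
  interpret comm_group G by fact
  show ?case by (simp add: generate_empty)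
next
  case (insert a A)
  let ?H = "generate G A"
  have IH: "finite ?H" "card ?H \<le> 2 ^ card A" using insert by auto
  have sub: "generate G (insert a A) \<subseteq> ?H \<union> (\<lambda>x. a \<otimes> x) ` ?H"
    using insert.prems by (intro generate_insert_involution[OF assms(1)]) auto
  have "card (generate G (insert a A)) \<le> card (?H \<union> (\<lambda>x. a \<otimes> x) ` ?H)"
    using IH(1) by (intro card_mono[OF _ sub]) auto
  also have "\<dots> \<le> card ?H + card ?H"
    using card_Un_le[of ?H "(\<lambda>x. a \<otimes> x) ` ?H"] card_image_le[OF IH(1), of "\<lambda>x. a \<otimes> x"] by linarith
  also have "\<dots> \<le> 2 ^ card (insert a A)" using IH(2) insert.hyps by simp
  finally show ?case using finite_subset[OF sub] IH(1) by simp
qed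

section \<open>The abelian group and its automorphism\<close>

text \<open>
  Negation on \<open>K\<close> fixes \<open>0\<close> and the element of order 2. The latter is the one element of \<open>K\<close>
  that carries no line, so negation has one fixed point on the labels in use, as the swap has on the
  slopes.
\<close>
lemma negation_fixed_points:
  assumes "u \<in> carrier (K_group q)" "group.ord (K_group q) u = 2"
  shows "{k \<in> carrier (K_group q) - {u}. inv\<^bsub>K_group q\<^esub> k = k} = {0}"
    "inv\<^bsub>K_group q\<^esub> u = u"
proof -
  interpret K: group "K_group q" by (simp add: K_group_def)
  have c: "carrier (K_group q) = {0..<int q + 2}"
    by (auto simp: K_group_def carrier_integer_mod_group)
  have inv: "inv\<^bsub>K_group q\<^esub> k = (- k) mod (int q + 2)" if "k \<in> carrier (K_group q)" for k
    using inv_integer_mod_group[of k "q + 2"] that by (simp add: K_group_def add.commute)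
  have sq: "inv\<^bsub>K_group q\<^esub> k = k \<longleftrightarrow> k = 0 \<or> 2 * k = int q + 2" if "k \<in> carrier (K_group q)" for k
  proof (cases "k = 0")
    case False
    then have "(- k) mod (int q + 2) = int q + 2 - k"
      using that c by (simp add: zmod_zminus1_eq_if)
    then show ?thesis using inv[OF that] False by auto
  qed (use inv[OF that] in simp)
  have u0: "u \<noteq> 0"
    using assms(2) K.ord_eq_1[OF assms(1)] by (auto simp: K_group_def)
  have "u [^]\<^bsub>K_group q\<^esub> (2::nat) = \<one>\<^bsub>K_group q\<^esub>"
    using K.pow_ord_eq_1[OF assms(1)] assms(2) by simp
  then have "u \<otimes>\<^bsub>K_group q\<^esub> u = \<one>\<^bsub>K_group q\<^esub>"
    using assms(1) by (simp add: numeral_2_eq_2)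
  then show iu: "inv\<^bsub>K_group q\<^esub> u = u"
    using K.inv_equality assms(1) by blast
  then have "2 * u = int q + 2" using sq assms(1) u0 by blast
  then show "{k \<in> carrier (K_group q) - {u}. inv\<^bsub>K_group q\<^esub> k = k} = {0}"
    using sq u0 c by auto
qed

lemma E_group_comm_group: "comm_group E_group"
  by (rule group.group_comm_groupI[OF E_group_group]) (simp add: add.commute)

lemma E_group_inv [simp]: "inv\<^bsub>E_group\<^esub> x = - x"
  by (rule group.inv_equality[OF E_group_group]) auto

lemma subgroup_E_group:
  assumes "subgroup M E_group"
  shows "0 \<in> M" "x \<in> M \<Longrightarrow> y \<in> M \<Longrightarrow> x + y \<in> M" "x \<in> M \<Longrightarrow> - x \<in> M"
  using subgroup.one_closed[OF assms] subgroup.m_closed[OF assms, of x y]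
    subgroup.m_inv_closed[OF assms, of x] by auto

lemma K_group_simps [simp]: "group (K_group q)" "\<one>\<^bsub>K_group q\<^esub> = 0"
  by (simp_all add: K_group_def)

lemma K_group_0 [simp]: "0 \<in> carrier (K_group q)"
  by (simp add: K_group_def)

lemma K_group_zero [simp]:
  assumes "k \<in> carrier (K_group q)"
  shows "0 \<otimes>\<^bsub>K_group q\<^esub> k = k" "k \<otimes>\<^bsub>K_group q\<^esub> 0 = k"
  using group.is_monoid[of "K_group q"] monoid.l_one[of "K_group q" k] monoid.r_one[of "K_group q" k] assms
  by simp_all

lemma EK_group_group: "group (EK_group q)"
  by (simp add: EK_group_def DirProd_group E_group_group)

lemma EK_group_simps [simp]:
  "carrier (EK_group q) = UNIV \<times> carrier (K_group q)"
  "(b, k) \<otimes>\<^bsub>EK_group q\<^esub> (c, l) = (b + c, k \<otimes>\<^bsub>K_group q\<^esub> l)"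
  "\<one>\<^bsub>EK_group q\<^esub> = (0, 0)"
  by (simp_all add: EK_group_def)

lemma phi_apply:
  "k \<in> carrier (K_group q) \<Longrightarrow> phi q (b, k) = (prod.swap b, inv\<^bsub>K_group q\<^esub> k)"
  by (cases b) (simp add: phi_def)

lemma phi_auto: "phi q \<in> auto (EK_group q)"
proof -
  interpret K: comm_group "K_group q" by (simp add: K_group_def)
  have "phi q \<in> extensional (carrier (EK_group q))" unfolding phi_def by simp
  moreover have "bij_betw (phi q) (carrier (EK_group q)) (carrier (EK_group q))"
    by (rule bij_betw_byWitness[of _ "phi q"]) (auto simp: phi_apply)
  moreover have "phi q \<in> hom (EK_group q) (EK_group q)"
    by (rule homI) (auto simp: phi_apply K.inv_mult)
  ultimately show ?thesis by (simp add: auto_def Bij_def)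
qed

lemma phi_involution: "phi q \<otimes>\<^bsub>AutoGroup (EK_group q)\<^esub> phi q = \<one>\<^bsub>AutoGroup (EK_group q)\<^esub>"
proof -
  interpret K: group "K_group q" by simp
  show ?thesis
    unfolding mult_AutoGroup[OF phi_auto phi_auto] one_AutoGroup
    by (auto simp: compose_def phi_apply fun_eq_iff)
qed

lemma phi_subgroup: "subgroup (generate (AutoGroup (EK_group q)) {phi q}) (AutoGroup (EK_group q))"
  by (intro group.generate_is_subgroup group.AutoGroup EK_group_group) (simp add: phi_auto)

lemma phi_EK_group_group: "group (phi_EK_group q)"
  unfolding phi_EK_group_def by (intro semidirect_group EK_group_group phi_subgroup)

section \<open>The twisted group as a graph over the points\<close>

text \<open>
  An explicit form of the twisted group. Each point \<open>(b, k)\<close> carries exactly one automorphism, which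
  is trivial or the involution according to the coset of \<open>M\<close> that contains \<open>b\<close>, so
  that the second component identifies the elements of the group with the points.
\<close>
definition coset_graph ::
  "nat \<Rightarrow> ('a::{field,finite} \<times> 'a) set \<Rightarrow>
     (((('a \<times> 'a) \<times> int) \<Rightarrow> (('a \<times> 'a) \<times> int)) \<times> (('a \<times> 'a) \<times> int)) set" where
  "coset_graph q M =
     {(\<alpha>, (b, k)). k \<in> carrier (K_group q) \<and>
        \<alpha> = (if b \<in> M then \<one>\<^bsub>AutoGroup (EK_group q)\<^esub> else phi q)}"

lemma coset_graph_iff:
  "(\<alpha>, (b, k)) \<in> coset_graph q M \<longleftrightarrow>
     k \<in> carrier (K_group q) \<and> \<alpha> = (if b \<in> M then \<one>\<^bsub>AutoGroup (EK_group q)\<^esub> else phi q)"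
  by (auto simp: coset_graph_def)

lemma phi_EK_group_simps:
  fixes b c :: "'a::{field,finite} \<times> 'a"
  shows "\<one>\<^bsub>phi_EK_group q\<^esub> = (\<one>\<^bsub>AutoGroup (EK_group q)\<^esub>, (0 :: 'a \<times> 'a, 0))"
    and "(\<one>\<^bsub>AutoGroup (EK_group q)\<^esub>, (b, k)) \<in> carrier (phi_EK_group q) \<longleftrightarrow> k \<in> carrier (K_group q)"
    and "(phi q, (b, k)) \<in> carrier (phi_EK_group q) \<longleftrightarrow> k \<in> carrier (K_group q)"
    and "\<alpha> \<in> {\<one>\<^bsub>AutoGroup (EK_group q)\<^esub>, phi q} \<Longrightarrow> k \<in> carrier (K_group q) \<Longrightarrow>
         (\<alpha>, (b, k)) \<otimes>\<^bsub>phi_EK_group q\<^esub> (\<one>\<^bsub>AutoGroup (EK_group q)\<^esub>, (c, l)) = (\<alpha>, (b + c, k \<otimes>\<^bsub>K_group q\<^esub> l))"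
    and "k \<in> carrier (K_group q) \<Longrightarrow>
         (\<one>\<^bsub>AutoGroup (EK_group q)\<^esub>, (b, k)) \<otimes>\<^bsub>phi_EK_group q\<^esub> (phi q, (c, l)) =
         (phi q, (prod.swap b + c, inv\<^bsub>K_group q\<^esub> k \<otimes>\<^bsub>K_group q\<^esub> l))"
    and "k \<in> carrier (K_group q) \<Longrightarrow>
         (phi q, (b, k)) \<otimes>\<^bsub>phi_EK_group q\<^esub> (phi q, (c, l)) =
         (\<one>\<^bsub>AutoGroup (EK_group q)\<^esub>, (prod.swap b + c, inv\<^bsub>K_group q\<^esub> k \<otimes>\<^bsub>K_group q\<^esub> l))"
proof -
  interpret Aut: group "AutoGroup (EK_group q :: (('a \<times> 'a) \<times> int) monoid)"
    by (intro group.AutoGroup EK_group_group)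
  note [simp] = phi_auto phi_involution phi_apply
  have [simp]: "\<one>\<^bsub>AutoGroup (EK_group q)\<^esub> \<in> auto (EK_group q :: (('a \<times> 'a) \<times> int) monoid)"
    using Aut.one_closed by simp
  have one_apply: "\<one>\<^bsub>AutoGroup (EK_group q)\<^esub> (b, k) = (b, k)" if "k \<in> carrier (K_group q)" for b :: "'a \<times> 'a" and k
    using that by (simp add: one_AutoGroup)
  let ?id = "\<one>\<^bsub>AutoGroup (EK_group q :: (('a \<times> 'a) \<times> int) monoid)\<^esub>"
  let ?Aut = "AutoGroup (EK_group q :: (('a \<times> 'a) \<times> int) monoid)"
  have phi1: "phi q \<otimes>\<^bsub>?Aut\<^esub> ?id = phi q" "?id \<otimes>\<^bsub>?Aut\<^esub> phi q = phi q"
    "?id \<otimes>\<^bsub>?Aut\<^esub> ?id = ?id"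
    by (simp_all add: Aut.r_one Aut.l_one)
  show "\<one>\<^bsub>phi_EK_group q\<^esub> = (?id, (0 :: 'a \<times> 'a, 0))"
    "(\<one>\<^bsub>AutoGroup (EK_group q)\<^esub>, (b, k)) \<in> carrier (phi_EK_group q) \<longleftrightarrow> k \<in> carrier (K_group q)"
    "(phi q, (b, k)) \<in> carrier (phi_EK_group q) \<longleftrightarrow> k \<in> carrier (K_group q)"
    by (simp_all add: phi_EK_group_def generate.one generate.incl)
  show "\<alpha> \<in> {\<one>\<^bsub>AutoGroup (EK_group q)\<^esub>, phi q} \<Longrightarrow> k \<in> carrier (K_group q) \<Longrightarrow>
         (\<alpha>, (b, k)) \<otimes>\<^bsub>phi_EK_group q\<^esub> (\<one>\<^bsub>AutoGroup (EK_group q)\<^esub>, (c, l)) = (\<alpha>, (b + c, k \<otimes>\<^bsub>K_group q\<^esub> l))"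
    by (auto simp: phi_EK_group_def phi1 one_apply)
  show "k \<in> carrier (K_group q) \<Longrightarrow>
         (\<one>\<^bsub>AutoGroup (EK_group q)\<^esub>, (b, k)) \<otimes>\<^bsub>phi_EK_group q\<^esub> (phi q, (c, l)) =
         (phi q, (prod.swap b + c, inv\<^bsub>K_group q\<^esub> k \<otimes>\<^bsub>K_group q\<^esub> l))"
    "k \<in> carrier (K_group q) \<Longrightarrow>
         (phi q, (b, k)) \<otimes>\<^bsub>phi_EK_group q\<^esub> (phi q, (c, l)) =
         (\<one>\<^bsub>AutoGroup (EK_group q)\<^esub>, (prod.swap b + c, inv\<^bsub>K_group q\<^esub> k \<otimes>\<^bsub>K_group q\<^esub> l))"
    by (simp_all add: phi_EK_group_def phi1)
qed

text \<open>
  Multiplication by an element over \<open>c\<close> sends the point over \<open>b\<close> to one over \<open>b + c\<close> or over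
  \<open>prod.swap b + c\<close>. As \<open>M\<close> has index 2 and is invariant under the swap, both lie in the same
  coset of \<open>M\<close>, and the automorphism parts multiply like the two cosets.
\<close>
lemma coset_graph_subgroup:
  fixes M :: "('a::{field,finite} \<times> 'a) set"
  assumes char2: "\<And>x::'a. x + x = 0" and M: "subgroup M E_group"
    and swap: "\<And>b. b \<in> M \<Longrightarrow> prod.swap b \<in> M"
    and index: "\<And>b c. b \<notin> M \<Longrightarrow> c \<notin> M \<Longrightarrow> b + c \<in> M"
  shows "subgroup (coset_graph q M) (phi_EK_group q)"
proof -
  interpret S: group "phi_EK_group q" by (rule phi_EK_group_group)
  interpret K: group "K_group q" by simp
  note M = subgroup_E_group[OF M]
  have swap_iff: "prod.swap b \<in> M \<longleftrightarrow> b \<in> M" for b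
    using swap[of b] swap[of "prod.swap b"] by auto
  have dbl: "b + b = 0" for b :: "'a \<times> 'a"
    by (cases b) (simp add: char2 zero_prod_def)
  have mixed: "b + c \<notin> M" "c + b \<notin> M" if "b \<in> M" "c \<notin> M" for b c
  proof -
    have "c = - b + (b + c)" by simp
    then show "b + c \<notin> M" using M(2)[OF M(3)[OF that(1)]] that(2) by metis
    then show "c + b \<notin> M" by (simp add: add.commute)
  qed
  show ?thesis
  proof (rule S.subgroupI)
    show "coset_graph q M \<subseteq> carrier (phi_EK_group q)"
    proof
      fix t assume "t \<in> coset_graph q M"
      moreover obtain \<alpha> b k where "t = (\<alpha>, (b, k))" by (metis surj_pair)
      ultimately show "t \<in> carrier (phi_EK_group q)"
        by (cases "b \<in> M") (simp_all add: coset_graph_iff phi_EK_group_simps(2,3))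
    qed
    have "(\<one>\<^bsub>AutoGroup (EK_group q)\<^esub>, (0, 0)) \<in> coset_graph q M"
      using M(1) by (simp add: coset_graph_iff)
    then show "coset_graph q M \<noteq> {}" by (metis empty_iff)
    show "t \<otimes>\<^bsub>phi_EK_group q\<^esub> s \<in> coset_graph q M" if "t \<in> coset_graph q M" "s \<in> coset_graph q M" for t s
    proof -
      obtain \<alpha> b k \<beta> c l where ts: "t = (\<alpha>, (b, k))" "s = (\<beta>, (c, l))"
        by (metis surj_pair)
      show ?thesis
        using that unfolding ts
        by (auto simp: coset_graph_iff phi_EK_group_simps swap_iff M mixed index split: if_splits)
    qed
    show "inv\<^bsub>phi_EK_group q\<^esub> t \<in> coset_graph q M" if t: "t \<in> coset_graph q M" for t
    proof -
      obtain \<alpha> b k where tb: "t = (\<alpha>, (b, k))" by (metis surj_pair)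
      have k: "k \<in> carrier (K_group q)" using t by (simp add: tb coset_graph_iff)
      show ?thesis
      proof (cases "b \<in> M")
        case True
        let ?s = "(\<one>\<^bsub>AutoGroup (EK_group q)\<^esub>, (- b, inv\<^bsub>K_group q\<^esub> k))"
        have "?s \<otimes>\<^bsub>phi_EK_group q\<^esub> t = \<one>\<^bsub>phi_EK_group q\<^esub>"
          using t True k K.l_inv by (simp add: tb coset_graph_iff phi_EK_group_simps)
        then have "inv\<^bsub>phi_EK_group q\<^esub> t = ?s"
          using t True k by (intro S.inv_equality) (auto simp: tb coset_graph_iff phi_EK_group_simps)
        then show ?thesis using True k M(3) by (simp add: coset_graph_iff)
      next
        case False
        \<comment> \<open>The inverse keeps \<open>k\<close>, which the other factor \<open>phi q\<close> negates.\<close>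
        let ?s = "(phi q, (prod.swap b, k))"
        have "?s \<otimes>\<^bsub>phi_EK_group q\<^esub> t = \<one>\<^bsub>phi_EK_group q\<^esub>"
          using t False k K.l_inv dbl by (simp add: tb coset_graph_iff phi_EK_group_simps)
        then have "inv\<^bsub>phi_EK_group q\<^esub> t = ?s"
          using t False k by (intro S.inv_equality) (auto simp: tb coset_graph_iff phi_EK_group_simps)
        then show ?thesis using False k swap_iff by (simp add: coset_graph_iff)
      qed
    qed
  qed
qed

text \<open>
  Both \<open>E\<close> and \<open>K\<close> embed into the semidirect product, so the generators with trivial automorphism
  generate all of \<open>M \<times> K\<close>; multiplying by the one generator with automorphism \<open>phi q\<close> reaches
  everything over the other coset of \<open>M\<close>.
\<close>
lemma generate_eq_coset_graph:
  fixes B :: "('a::{field,finite} \<times> 'a) set" and Y :: "int set"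
  defines "M \<equiv> generate E_group B"
  assumes sub: "subgroup (coset_graph q M) (phi_EK_group q)"
    and index: "\<And>b c. b \<notin> M \<Longrightarrow> c \<notin> M \<Longrightarrow> b + c \<in> M"
    and w: "w \<notin> M"
    and Y: "Y \<subseteq> carrier (K_group q)" "generate (K_group q) Y = carrier (K_group q)"
  shows "generate (phi_EK_group q)
           ({(phi q, (w, 0))} \<union> {\<one>\<^bsub>AutoGroup (EK_group q)\<^esub>} \<times> ({0} \<times> Y \<union> B \<times> {0})) = coset_graph q M"
proof -
  let ?S = "phi_EK_group q :: (((('a \<times> 'a) \<times> int) \<Rightarrow> (('a \<times> 'a) \<times> int)) \<times> (('a \<times> 'a) \<times> int)) monoid"
  let ?id = "\<one>\<^bsub>AutoGroup (EK_group q :: (('a \<times> 'a) \<times> int) monoid)\<^esub>"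
  let ?A = "{(phi q, (w, 0 :: int))}"
  let ?jK = "\<lambda>k :: int. (?id, (0 :: 'a \<times> 'a, k))"
  let ?jE = "\<lambda>b :: 'a \<times> 'a. (?id, (b, 0 :: int))"
  interpret S: group ?S by (rule phi_EK_group_group)
  interpret K: group "K_group q" by simp
  interpret E: group E_group by (rule E_group_group)
  have M: "subgroup M E_group" unfolding M_def by (rule E.generate_is_subgroup) simp
  note M' = subgroup_E_group[OF M]
  have XM: "B \<subseteq> M" unfolding M_def by (auto intro: generate.incl)
  have gens: "?A \<union> {?id} \<times> ({0} \<times> Y \<union> B \<times> {0}) = ?A \<union> ?jK ` Y \<union> ?jE ` B" by auto
  have upper: "generate ?S (?A \<union> ?jK ` Y \<union> ?jE ` B) \<subseteq> coset_graph q M"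
    using w XM Y(1) K.one_closed M'(1)
    by (intro S.generate_subgroup_incl[OF _ sub]) (auto simp: coset_graph_iff)
  let ?H = "generate ?S (?A \<union> ?jK ` Y \<union> ?jE ` B)"
  have "?A \<union> ?jK ` Y \<union> ?jE ` B \<subseteq> carrier ?S"
    using Y(1) K.one_closed by (auto simp: phi_EK_group_simps)
  then have H: "subgroup ?H ?S" by (rule S.generate_is_subgroup)
  interpret jE: group_hom E_group ?S ?jE
    by unfold_locales (auto intro!: homI simp: phi_EK_group_simps)
  interpret jK: group_hom "K_group q" ?S ?jK
    by unfold_locales (auto intro!: homI simp: phi_EK_group_simps)
  have "generate ?S (?jE ` B) \<subseteq> ?H" by (rule S.mono_generate) blast
  then have "?jE ` M \<subseteq> ?H"
    unfolding M_def using jE.generate_img[of B] by simp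
  then have jE: "?jE m \<in> ?H" if "m \<in> M" for m using that by blast
  have "generate ?S (?jK ` Y) \<subseteq> ?H" by (rule S.mono_generate) blast
  then have "?jK ` carrier (K_group q) \<subseteq> ?H"
    using jK.generate_img[OF Y(1)] Y(2) by simp
  then have jK: "?jK k \<in> ?H" if "k \<in> carrier (K_group q)" for k using that by blast
  have idH: "(\<one>\<^bsub>AutoGroup (EK_group q)\<^esub>, (m, k)) \<in> ?H" if "m \<in> M" "k \<in> carrier (K_group q)" for m k
    using subgroup.m_closed[OF H jE[OF that(1)] jK[OF that(2)]] that
    by (simp add: phi_EK_group_simps)
  have phiH: "(phi q, (b, k)) \<in> ?H" if "b \<notin> M" "k \<in> carrier (K_group q)" for b k
  proof -
    have "- w \<notin> M" using M'(3)[of "- w"] w by auto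
    then have m: "- w + b \<in> M" using index that(1) by blast
    have "(phi q, (w, 0)) \<in> ?H" by (rule generate.incl) simp
    from subgroup.m_closed[OF H this idH[OF m that(2)]] show ?thesis
      using that by (simp add: phi_EK_group_simps)
  qed
  have "coset_graph q M \<subseteq> ?H"
    using idH phiH by (auto simp: coset_graph_iff)
  with upper show ?thesis unfolding gens by (rule subset_antisym)
qed

text \<open>
  If \<open>w\<close> were in the subgroup generated by \<open>B\<close>, then \<open>B\<close> would generate the whole plane, which
  is larger than \<open>2 ^ card B\<close>. So that subgroup has exactly two cosets, and two elements of the
  nontrivial one add up to an element of the subgroup.
\<close>
lemma generate_index_two:
  fixes B :: "('a::{field,finite} \<times> 'a) set"
  assumes char2: "\<And>x::'a. x + x = 0"
    and gen: "generate E_group (insert w B) = UNIV"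
    and card: "2 ^ card B < CARD('a \<times> 'a)"
  shows "w \<notin> generate E_group B"
    and "b \<notin> generate E_group B \<Longrightarrow> c \<notin> generate E_group B \<Longrightarrow> b + c \<in> generate E_group B"
proof -
  interpret E: comm_group E_group by (rule E_group_comm_group)
  let ?M = "generate E_group B"
  have dbl: "b + b = 0" for b :: "'a \<times> 'a"
    by (cases b) (simp add: char2 zero_prod_def)
  have M: "subgroup ?M E_group" by (rule E.generate_is_subgroup) simp
  note M' = subgroup_E_group[OF M]
  have cover: "UNIV = ?M \<union> (\<lambda>x. w + x) ` ?M"
    using generate_insert_involution[OF E_group_comm_group, of B w] gen dbl by auto
  show w: "w \<notin> ?M"
  proof
    assume "w \<in> ?M"
    then have "?M = UNIV" using cover M'(2) by blast
    moreover have "card ?M \<le> 2 ^ card B"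
      using card_generate_involutions[OF E_group_comm_group, of B] dbl by auto
    ultimately show False using card by simp
  qed
  show "b + c \<in> ?M" if bc: "b \<notin> ?M" "c \<notin> ?M"
  proof -
    obtain m n where "b = w + m" "c = w + n" "m \<in> ?M" "n \<in> ?M" using cover bc by blast
    moreover have "(w + m) + (w + n) = (w + w) + (m + n)" by (simp add: algebra_simps)
    ultimately show ?thesis using dbl[of w] M'(2) by (metis add_0)
  qed
qed

section \<open>The invariant difference set\<close>

text \<open>
  The freedom in McFarland's construction is the choice of which line lies over which \<open>k\<close>. It is
  used to make the result invariant under \<open>phi q\<close>: the labels \<open>k\<close> with negation and the slopes
  with the swap are both sets of \<open>q + 1\<close> elements with one fixed point.
\<close>
lemma equivariant_slope_labelling:
  assumes "CARD('a::{field,finite}) = q" "\<And>x::'a. x + x = 0"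
    and u: "u \<in> carrier (K_group q)" "group.ord (K_group q) u = 2"
  shows "\<exists>h :: int \<Rightarrow> 'a option. bij_betw h (carrier (K_group q) - {u}) UNIV \<and>
           (\<forall>k\<in>carrier (K_group q) - {u}. h (inv\<^bsub>K_group q\<^esub> k) = swap_slope (h k))"
proof -
  interpret K: group "K_group q" by simp
  note neg = negation_fixed_points[OF u]
  show ?thesis
  proof (rule involutions_equivalent)
    show "finite (carrier (K_group q) - {u})"
      by (simp add: K_group_def carrier_integer_mod_group)
    show "card (carrier (K_group q) - {u}) = card (UNIV :: 'a option set)"
      using u(1) assms(1) by (simp add: card_Diff_subset K_group_def carrier_integer_mod_group card_UNIV_option)
    show "inv\<^bsub>K_group q\<^esub> k \<in> carrier (K_group q) - {u}" if "k \<in> carrier (K_group q) - {u}" for k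
      using that neg(2) K.inv_inv[of k] by auto
    show "card {k \<in> carrier (K_group q) - {u}. inv\<^bsub>K_group q\<^esub> k = k} =
          card {s \<in> UNIV :: 'a option set. swap_slope s = s}"
      using neg(1) swap_slope_fixed[OF assms(2)] by simp
  qed (auto simp: swap_slope_involution)
qed

lemma phi_invariant_difference_set:
  assumes "CARD('a::{field,finite}) = q" "\<And>x::'a. x + x = 0"
    and u: "u \<in> carrier (K_group q)" "group.ord (K_group q) u = 2"
  shows "\<exists>D. difference_set (EK_group q :: (('a \<times> 'a) \<times> int) monoid) D (q\<^sup>2 * (q + 2)) (q * (q + 1)) q
             \<and> phi q ` D \<subseteq> D"
proof -
  interpret K: group "K_group q" by simp
  note neg = negation_fixed_points[OF u]
  let ?I = "carrier (K_group q) - {u}"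
  obtain h :: "int \<Rightarrow> 'a option" where h: "bij_betw h ?I UNIV"
    "\<And>k. k \<in> ?I \<Longrightarrow> h (inv\<^bsub>K_group q\<^esub> k) = swap_slope (h k)"
    using equivariant_slope_labelling[OF assms] by blast
  let ?D = "{(v, k). k \<in> ?I \<and> v \<in> slope_line (h k)}"
  have "difference_set (E_group \<times>\<times> K_group q) ?D (q\<^sup>2 * (q + 2)) (q * (q + 1)) q"
  proof (rule spread_difference_set)
    show "group E_group" "group (K_group q)" by (simp_all add: E_group_group)
    show "finite (carrier E_group)" "finite (carrier (K_group q))"
      by (simp_all add: K_group_def carrier_integer_mod_group)
    show "order (E_group :: ('a \<times> 'a) monoid) = q\<^sup>2"
      using assms(1) by (simp add: order_def power2_eq_square)
    show "order (K_group q) = q + 2" by (simp add: order_def K_group_def carrier_integer_mod_group)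
    show "\<exists>!k. k \<in> ?I \<and> a \<in> slope_line (h k)" if ne: "a \<noteq> \<one>\<^bsub>E_group\<^esub>" for a
    proof -
      obtain s where s: "a \<in> slope_line s" "\<And>t. a \<in> slope_line t \<Longrightarrow> t = s"
        using slope_lines_spread[of a] ne by auto
      have "s \<in> h ` ?I" using bij_betw_imp_surj_on[OF h(1)] by simp
      then obtain k where k: "k \<in> ?I" "h k = s" by blast
      show ?thesis
      proof (rule ex1I[of _ k])
        show "k \<in> ?I \<and> a \<in> slope_line (h k)" using k s(1) by simp
        show "k' = k" if "k' \<in> ?I \<and> a \<in> slope_line (h k')" for k'
        proof (rule inj_onD[OF bij_betw_imp_inj_on[OF h(1)]])
          show "h k' = h k" using s(2)[of "h k'"] that k(2) by simp
        qed (use that k(1) in blast)+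
      qed
    qed
  qed (use u assms(1) in \<open>auto simp: slope_line_subgroup card_slope_line\<close>)
  moreover have "phi q ` ?D \<subseteq> ?D"
  proof
    fix p assume "p \<in> phi q ` ?D"
    then obtain v k where k: "k \<in> ?I" "v \<in> slope_line (h k)" "p = phi q (v, k)" by auto
    have "inv\<^bsub>K_group q\<^esub> k \<in> ?I" using k(1) neg(2) K.inv_inv[of k] by auto
    moreover have "prod.swap v \<in> slope_line (h (inv\<^bsub>K_group q\<^esub> k))"
      using swap_slope_line[of "h k"] k(2) h(2)[OF k(1)] by auto
    ultimately show "p \<in> ?D" using k by (simp add: phi_apply)
  qed
  ultimately show ?thesis unfolding EK_group_def by blast
qed

section \<open>The nonabelian difference set\<close>

theorem theorem7p7:
  fixes d q :: nat
    and e :: "nat \<Rightarrow> 'a::{field,finite} \<times> 'a"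
    and u y :: int
  assumes "d > 0"
    and "q = 2 ^ d"
    and "CARD('a) = q"
    and "generate E_group (e ` {1..2 * d}) = carrier E_group"
    and "e 1 = (1, 0)" and "e 2 = (0, 1)"
    and "\<forall>b \<in> generate E_group (insert (e 1 + e 2) (e ` {3..2 * d})).
           prod.swap b \<in> generate E_group (insert (e 1 + e 2) (e ` {3..2 * d}))"
    and "u \<in> carrier (K_group q)" and "group.ord (K_group q) u = 2"
    and "y \<in> carrier (K_group q)" and "generate (K_group q) {u, y} = carrier (K_group q)"
    and "q \<noteq> 2 \<longrightarrow> group.ord (K_group q) y = (q + 2) div 2"
  shows "group (twisted_group d q e u y)
       \<and> \<not> comm_group (twisted_group d q e u y)
       \<and> mcfarland_parameters q 1 = (q\<^sup>2 * (q + 2), q * (q + 1), q)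
       \<and> (\<exists>D. difference_set (twisted_group d q e u y) D (q\<^sup>2 * (q + 2)) (q * (q + 1)) q)"
proof -
  interpret E: comm_group E_group by (rule E_group_comm_group)
  interpret K: group "K_group q" by simp
  let ?S = "phi_EK_group q :: (((('a \<times> 'a) \<times> int) \<Rightarrow> (('a \<times> 'a) \<times> int)) \<times> (('a \<times> 'a) \<times> int)) monoid"
  let ?id = "\<one>\<^bsub>AutoGroup (EK_group q :: (('a \<times> 'a) \<times> int) monoid)\<^esub>"
  interpret S: group ?S by (rule phi_EK_group_group)
  have char2: "x + x = 0" for x :: 'a using char_2_of_card assms(2,3) by metis
  define B where "B = insert (e 1 + e 2) (e ` {3..2 * d})"
  define M where "M = generate E_group B"
  have q2: "q \<ge> 2" using assms(1,2) by (auto simp: self_le_power)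
  have gen: "generate E_group (insert (e 1) B) = UNIV"
  proof -
    let ?H = "generate E_group (insert (e 1) B)"
    have H: "subgroup ?H E_group" by (rule E.generate_is_subgroup) simp
    have incl: "x \<in> ?H" if "x \<in> insert (e 1) B" for x using that by (rule generate.incl)
    have "e 2 = - e 1 + (e 1 + e 2)" by simp
    then have "e 2 \<in> ?H" using subgroup_E_group[OF H] incl by (metis B_def insertCI)
    moreover have "e i \<in> ?H" if "i \<in> {1..2 * d} - {2}" for i
    proof (rule incl)
      show "e i \<in> insert (e 1) B"
        using that by (cases "i = 1") (auto simp: B_def)
    qed
    ultimately have "e ` {1..2 * d} \<subseteq> ?H" by blast
    then have "generate E_group (e ` {1..2 * d}) \<subseteq> ?H" using E.generate_subgroup_incl[OF _ H] by blast
    then show ?thesis using assms(4) by simp blast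
  qed
  have card: "2 ^ card B < CARD('a \<times> 'a)"
  proof -
    have "card B \<le> Suc (card {3..2 * d})"
      unfolding B_def using card_image_le[of "{3..2 * d}" e] by (intro card_insert_le_m1[THEN le_trans]) auto
    also have "\<dots> < 2 * d" using assms(1) by simp
    finally have "(2::nat) ^ card B < 2 ^ (2 * d)" by simp
    also have "\<dots> = CARD('a \<times> 'a)" unfolding mult_2 power_add using assms(2,3) by simp
    finally show ?thesis .
  qed
  note M_index = generate_index_two[OF char2 gen card, folded M_def]
  have M: "subgroup M E_group" unfolding M_def by (rule E.generate_is_subgroup) simp
  have T: "subgroup (coset_graph q M) ?S"
    using assms(7) M_index by (intro coset_graph_subgroup char2 M) (auto simp: M_def B_def)
  have tw: "twisted_group d q e u y = ?S\<lparr>carrier := coset_graph q M\<rparr>"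
  proof -
    have gens: "{(phi q, (e 1, 0)), (?id, (0, y)), (?id, (0, u)), (?id, (e 1 + e 2, 0))}
            \<union> {(?id, (e i, 0)) | i. i \<in> {3..2 * d}} =
          {(phi q, (e 1, 0))} \<union> {?id} \<times> ({0} \<times> {u, y} \<union> B \<times> {0})"
      unfolding B_def by auto
    show ?thesis
      unfolding twisted_group_def Let_def gens M_def
      using T M_index assms(8,10,11) by (subst generate_eq_coset_graph) (auto simp: M_def)
  qed
  have grp: "group (twisted_group d q e u y)"
    unfolding tw by (rule subgroup.subgroup_is_group[OF T S.is_group])
  \<comment> \<open>Conjugation by \<open>(phi q, (e 1, 0))\<close> negates \<open>K\<close>, and \<open>1 \<noteq> - 1\<close> in \<open>K\<close> as \<open>q + 2 > 2\<close>.\<close>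
  have nonabelian: "\<not> comm_group (twisted_group d q e u y)"
  proof
    assume "comm_group (twisted_group d q e u y)"
    then interpret comm_group "?S\<lparr>carrier := coset_graph q M\<rparr>" by (simp add: tw)
    have one: "1 \<in> carrier (K_group q)" by (simp add: K_group_def)
    have "(phi q, (e 1, 0)) \<in> coset_graph q M" "(?id, (0, 1)) \<in> coset_graph q M"
      using M_index(1) subgroup_E_group(1)[OF M] one by (auto simp: coset_graph_iff)
    then have "(phi q, (e 1, 0)) \<otimes>\<^bsub>?S\<^esub> (?id, (0, 1)) = (?id, (0, 1)) \<otimes>\<^bsub>?S\<^esub> (phi q, (e 1, 0))"
      using m_comm[of "(phi q, (e 1, 0))" "(?id, (0, 1))"] by simp
    then have "1 = inv\<^bsub>K_group q\<^esub> 1"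
      using one K.r_one[of "inv\<^bsub>K_group q\<^esub> 1"] K.l_one[OF one] by (simp add: phi_EK_group_simps)
    also have "\<dots> = (- 1) mod (int q + 2)"
      using inv_integer_mod_group[of 1 "q + 2"] one by (simp add: K_group_def add.commute)
    also have "\<dots> = int q + 1" by (simp add: zmod_minus1)
    finally show False using q2 by simp
  qed
  have params: "mcfarland_parameters q 1 = (q\<^sup>2 * (q + 2), q * (q + 1), q)"
  proof -
    have "q\<^sup>2 - 1 = (q + 1) * (q - 1)"
      using q2 by (simp add: algebra_simps power2_eq_square)
    moreover have "(q + 1) * (q - 1) div (q - 1) = q + 1"
      using q2 by (intro nonzero_mult_div_cancel_right) simp
    ultimately have quot: "(q\<^sup>2 - 1) div (q - 1) = q + 1" by (simp only:)
    have "mcfarland_parameters q 1 =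
        (q\<^sup>2 * ((q\<^sup>2 - 1) div (q - 1) + 1), q * ((q\<^sup>2 - 1) div (q - 1)), q * ((q - 1) div (q - 1)))"
      by (simp add: mcfarland_parameters_def power2_eq_square)
    then show ?thesis unfolding quot using q2 by simp
  qed
  obtain D :: "(('a \<times> 'a) \<times> int) set" where
    D: "difference_set (EK_group q) D (q\<^sup>2 * (q + 2)) (q * (q + 1)) q" "phi q ` D \<subseteq> D"
    using phi_invariant_difference_set[OF assms(3) char2 assms(8,9)] by blast
  have D_carrier: "D \<subseteq> carrier (EK_group q)" using D(1) by (simp add: difference_set_def)
  have "difference_set (twisted_group d q e u y) {t \<in> coset_graph q M. snd t \<in> D}
          (q\<^sup>2 * (q + 2)) (q * (q + 1)) q"
    unfolding tw phi_EK_group_def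
  proof (rule difference_set_regular_transfer[OF phi_subgroup _ _ D(1)])
    show "subgroup (coset_graph q M)
            (semidirect (generate (AutoGroup (EK_group q)) {phi q}) (EK_group q))"
      using T by (simp add: phi_EK_group_def)
    show "bij_betw snd (coset_graph q M) (carrier (EK_group q))"
      unfolding bij_betw_def
    proof
      show "inj_on snd (coset_graph q M)" by (auto simp: inj_on_def coset_graph_iff)
      have "(b, k) \<in> snd ` coset_graph q M" if "k \<in> carrier (K_group q)" for b k
        using that coset_graph_iff[of _ b k q M] by force
      then show "snd ` coset_graph q M = carrier (EK_group q)" by (auto simp: coset_graph_iff)
    qed
    show "fst t ` D \<subseteq> D" if "t \<in> coset_graph q M" for t
    proof -
      have "?id ` D \<subseteq> D" using D_carrier unfolding one_AutoGroup by auto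
      then show ?thesis using that D(2) by (cases t) (auto simp: coset_graph_iff split: if_splits)
    qed
  qed
  then show ?thesis using grp nonabelian params by blast
qed

end
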